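(* Let $N\ge 2$, let $H$ be a real Hilbert space, $X=H^N$, $I=\{1,\dots,N\}$, and let $\Gamma\subseteq X$ be a $c$-monotone set. Then the following assertions are equivalent: (i) for each $\varnothing\neq K\subsetneq I$ the mapping $A_K$ is maximally monotone; (ii) there exists $\varnothing\neq K\subsetneq I$ such that the mapping $A_K$ is maximally monotone; (iii) $\Gamma+\Delta^\perp=X$; (iv) $J_{A_1}+\cdots+J_{A_N}=\mathrm{Id}$ (as mappings on all of $H$); (v) for each $\varnothing\neq K\subsetneq I$ the firmly nonexpansive mapping $J_{A_K}:H\to H$ has full domain and $J_{A_K}=\sum_{i\in K}J_{A_i}$; (vi) $S(\Gamma)=H$. In this case, $\Gamma$ is maximally $c$-monotone.
   Context: $H$ is a real Hilbert space with inner product $\langle\cdot,\cdot\rangle$ and norm $\|\cdot\|$; $N\ge 2$ is an integer, $I=\{1,\dots,N\}$, $X=X_1\times\cdots\times X_N$ with every $X_i=H$. The cost function is $c:X\to\mathbb{R}$, $c(x_1,\dots,x_N)=\sum_{1\le i<j\le N}\langle x_i,x_j\rangle$. A set $\Gamma\subseteq X$ is $n$-$c$-monotone if for all $n$ tuples $(x_1^1,\dots,x_N^1),\dots,(x_1^n,\dots,x_N^n)$ in $\Gamma$ and all $N$ permutations $\sigma_1,\dots,\sigma_N\in S_n$, $\sum_{j=1}^n c(x_1^{\sigma_1(j)},\dots,x_N^{\sigma_N(j)})\le\sum_{j=1}^n c(x_1^j,\dots,x_N^j)$. $\Gamma$ is $c$-monotone if it is $2$-$c$-monotone, and maximally $c$-monotone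 if it is $c$-monotone and has no proper $c$-monotone extension in $X$. The sum mapping is $S:X\to H$, $S(x_1,\dots,x_N)=\sum_{i\in I}x_i$. $\Delta=\{(x,\dots,x)\mid x\in H\}\subseteq X$, so $\Delta^\perp=\{(x_1,\dots,x_N)\in X\mid\sum_{i=1}^N x_i=0\}$. For $\varnothing\ne K\subsetneq I$, the set-valued mapping $A_K:H\rightrightarrows H$ is defined through its graph: $\operatorname{gra}A_K=\{(\sum_{i\in K}x_i,\sum_{i\in I\setminus K}x_i)\mid(x_1,\dots,x_N)\in\Gamma\}$; and $A_i=A_{\{i\}}$. A set-valued $A:H\rightrightarrows H$ is monotone if $\langle x-y,u-v\rangle\ge0$ for all $(x,u),(y,v)\in\operatorname{gra}A$, and maximally monotone if it is monotone and its graph is not properly contained in the graph of another monotone operator. Its resolvent is $J_A=(A+\mathrm{Id})^{-1}$ (inverse as a set-valued mapping). A mapping $T:\operatorname{dom}T\subseteq H\to H$ is firmly nonexpansive if $\|Tx-Ty\|^2+\|(\mathrm{Id}-T)x-(\mathrm{Id}-T)y\|^2\le\|x-y\|^2$ for all $x,y\in\operatorname{dom}T$. For $c$-monotone $\Gamma$ the resolvents $J_{A_K}$ are single-valued and firmly nonexpansive on their domain $S(\Gamma)$. *)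

theory Defs
  imports "HOL-Analysis.Analysis" "HOL-Library.Set_Algebras"
begin

text \<open>
  The product \<open>X = H\<^sup>N\<close> is the type \<open>'h ^ 'n\<close>, where the finite linearly ordered index type \<open>'n\<close>
  plays the role of \<open>I = {1,\<dots>,N}\<close>, so \<open>N = CARD('n)\<close>. Its inner product is the sum of the
  componentwise inner products.

  Set-valued mappings are functions \<open>'h \<Rightarrow> 'h set\<close>. Sums of sets are Minkowski sums
  (\<open>Set_Algebras\<close>), so sums of set-valued mappings are pointwise Minkowski sums; in particular
  a sum is empty at every point where one of the summands is.
\<close>

definition gra :: "('h \<Rightarrow> 'h set) \<Rightarrow> ('h \<times> 'h) set" where
  "gra A = {(x, u). u \<in> A x}"

definition op_dom :: "('h \<Rightarrow> 'h set) \<Rightarrow> 'h set" where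
  "op_dom A = {x. A x \<noteq> {}}"

definition monotone_op :: "('h::real_inner \<Rightarrow> 'h set) \<Rightarrow> bool" where
  "monotone_op A \<longleftrightarrow> (\<forall>(x, u) \<in> gra A. \<forall>(y, v) \<in> gra A. inner (x - y) (u - v) \<ge> 0)"

definition maximally_monotone_op :: "('h::real_inner \<Rightarrow> 'h set) \<Rightarrow> bool" where
  "maximally_monotone_op A \<longleftrightarrow>
     monotone_op A \<and> \<not> (\<exists>B. monotone_op B \<and> gra A \<subset> gra B)"

definition inverse_op :: "('h \<Rightarrow> 'h set) \<Rightarrow> 'h \<Rightarrow> 'h set" where
  "inverse_op A u = {x. u \<in> A x}"

definition resolvent :: "('h::real_inner \<Rightarrow> 'h set) \<Rightarrow> 'h \<Rightarrow> 'h set" where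
  "resolvent A = inverse_op (\<lambda>x. A x + {x})"

text \<open>
  A mapping \<open>T : dom T \<rightarrow> H\<close> is represented by a set-valued mapping that has exactly one value
  at each point of its domain.
\<close>

definition single_valued_op :: "('h \<Rightarrow> 'h set) \<Rightarrow> bool" where
  "single_valued_op T \<longleftrightarrow> (\<forall>x \<in> op_dom T. \<exists>!u. u \<in> T x)"

definition firmly_nonexpansive :: "('h::real_inner \<Rightarrow> 'h set) \<Rightarrow> bool" where
  "firmly_nonexpansive T \<longleftrightarrow> single_valued_op T \<and>
     (\<forall>(x, Tx) \<in> gra T. \<forall>(y, Ty) \<in> gra T.
        (norm (Tx - Ty))\<^sup>2 + (norm ((x - Tx) - (y - Ty)))\<^sup>2 \<le> (norm (x - y))\<^sup>2)"

definition cost :: "'h::real_inner ^ 'n::{finite,linorder} \<Rightarrow> real" where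
  "cost x = (\<Sum>(i, j) \<in> {(i, j). i < j}. inner (x $ i) (x $ j))"

definition n_c_monotone :: "nat \<Rightarrow> ('h::real_inner ^ 'n::{finite,linorder}) set \<Rightarrow> bool" where
  "n_c_monotone n \<Gamma> \<longleftrightarrow>
     (\<forall>(x :: nat \<Rightarrow> _) \<sigma>.
        (\<forall>j \<in> {1..n}. x j \<in> \<Gamma>) \<and> (\<forall>i. \<sigma> i permutes {1..n}) \<longrightarrow>
        (\<Sum>j = 1..n. cost (\<chi> i. x (\<sigma> i j) $ i)) \<le> (\<Sum>j = 1..n. cost (x j)))"

definition c_monotone :: "('h::real_inner ^ 'n::{finite,linorder}) set \<Rightarrow> bool" where
  "c_monotone \<Gamma> \<longleftrightarrow> n_c_monotone 2 \<Gamma>"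

definition maximally_c_monotone :: "('h::real_inner ^ 'n::{finite,linorder}) set \<Rightarrow> bool" where
  "maximally_c_monotone \<Gamma> \<longleftrightarrow> c_monotone \<Gamma> \<and> \<not> (\<exists>\<Gamma>'. c_monotone \<Gamma>' \<and> \<Gamma> \<subset> \<Gamma>')"

definition sum_map :: "'h::real_inner ^ 'n \<Rightarrow> 'h" where
  "sum_map x = (\<Sum>i \<in> UNIV. x $ i)"

definition diagonal :: "('h::real_inner ^ 'n) set" where
  "diagonal = range (\<lambda>x. \<chi> i. x)"

lemma orthogonal_comp_diagonal:
  "orthogonal_comp (diagonal :: ('h::real_inner ^ 'n::finite) set) = {x. (\<Sum>i \<in> UNIV. x $ i) = 0}"
proof -
  have "(\<forall>y. inner y (\<Sum>i \<in> UNIV. x $ i) = 0) \<longleftrightarrow> (\<Sum>i \<in> UNIV. x $ i) = 0" for x :: "'h ^ 'n"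
    by (metis inner_eq_zero_iff inner_zero_right)
  then show ?thesis
    by (auto simp: orthogonal_comp_def orthogonal_def diagonal_def inner_vec_def
        simp flip: inner_sum_right)
qed

definition splitting_op :: "('h::real_inner ^ 'n) set \<Rightarrow> 'n set \<Rightarrow> 'h \<Rightarrow> 'h set" where
  "splitting_op \<Gamma> K s = {t. (s, t) \<in> (\<lambda>x. (\<Sum>i \<in> K. x $ i, \<Sum>i \<in> UNIV - K. x $ i)) ` \<Gamma>}"

end

theory Submission
  imports Defs
begin

text \<open>
  Twice the cost is the squared norm of the sum minus the sum of the squared norms of the
  components, and exchanging the components in an index set \<open>K\<close> between two points preserves the
  latter. Hence \<open>c\<close>-monotonicity says that \<open>\<langle>s - s', t - t'\<rangle> \<ge> 0\<close> whenever two points of \<open>\<Gamma>\<close> are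
  split into partial sums \<open>(s, t)\<close> and \<open>(s', t')\<close> over \<open>K\<close> and its complement, i.e. that every
  splitting operator is monotone (lemma \<open>c_monotone_splitting\<close>). If the two points have the same
  total sum, the inner product is \<open>-\<parallel>s - s'\<parallel>\<^sup>2\<close>, so \<open>s = s'\<close>; with singletons \<open>K\<close> this shows that the
  sum mapping is injective on \<open>\<Gamma>\<close> (lemma \<open>c_monotone_inj_on_sum_map\<close>).

  The resolvent of \<open>A\<^sub>K\<close> at \<open>w\<close> consists of the partial sums over \<open>K\<close> of the points of \<open>\<Gamma>\<close> with total
  sum \<open>w\<close>. So the domain of every one of these resolvents is the range of the sum mapping on
  \<open>\<Gamma>\<close>, and, by injectivity, all of them are read off from the one point above \<open>w\<close>. Each of the six
  assertions thereby reduces to surjectivity of the sum mapping on \<open>\<Gamma>\<close>, and maximality of \<open>\<Gamma>\<close> follows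
  from it because an extension of \<open>\<Gamma>\<close> would contain a second point with the same sum.

  The one analytic ingredient is the link between maximality of \<open>A\<^sub>K\<close> and full domain of its
  resolvent, Minty's theorem. Its hard half (lemma \<open>minty_surjective\<close>) is obtained by minimising
  the Fitzpatrick function of the operator plus half the squared norm. This is a strongly
  convex problem, so minimising sequences are Cauchy, and completeness of \<open>H\<close> suffices without
  any appeal to weak compactness.
\<close>

section \<open>Minimising a quadratically perturbed convex function\<close>

text \<open>
  The set \<open>C\<close> is the epigraph of a lower semicontinuous convex function \<open>f\<close>; working with
  the epigraph allows \<open>f\<close> to take the value \<open>\<infinity>\<close>. The point obtained minimises \<open>f + \<parallel>\<cdot>\<parallel>\<^sup>2/2\<close>,
  and the inequality is the first-order optimality condition \<open>-z\<^sub>0 \<in> \<partial>f(z\<^sub>0)\<close>.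
\<close>

lemma quadratic_perturbation_minimizer:
  fixes C :: "('a::{real_inner,complete_space} \<times> real) set"
  assumes "closed C" and "convex C" and "C \<noteq> {}"
    and bounded_below: "\<And>z r. (z, r) \<in> C \<Longrightarrow> L \<le> r + (norm z)\<^sup>2 / 2"
  obtains z0 r0 where "(z0, r0) \<in> C"
    and "\<And>z r. (z, r) \<in> C \<Longrightarrow> r0 + inner z0 z0 \<le> r + inner z0 z"
proof -
  define g where "g = (\<lambda>p::'a \<times> real. snd p + (norm (fst p))\<^sup>2 / 2)"
  define m where "m = Inf (g ` C)"
  have bdd: "bdd_below (g ` C)"
    unfolding bdd_below_def g_def using bounded_below by force
  have m_le: "m \<le> g p" if "p \<in> C" for p
    unfolding m_def using bdd that by (simp add: cINF_lower)
  have "\<exists>p\<in>C. g p < m + 1 / real (Suc n)" for n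
    using cInf_lessD[of "g ` C" "m + 1 / real (Suc n)"] \<open>C \<noteq> {}\<close> unfolding m_def by auto
  then obtain P where P_in: "\<And>n. P n \<in> C" and P_less: "\<And>n. g (P n) < m + 1 / real (Suc n)"
    by metis
  have g_combination: "g ((1 - t) *\<^sub>R p + t *\<^sub>R q)
      = (1 - t) * g p + t * g q - t * (1 - t) / 2 * (norm (fst p - fst q))\<^sup>2" for t p q
    unfolding g_def power2_norm_eq_inner
    by (simp add: algebra_simps inner_commute) (simp add: field_simps)
  have combination_in: "(1 - t) *\<^sub>R p + t *\<^sub>R q \<in> C" if "p \<in> C" "q \<in> C" "0 \<le> t" "t \<le> 1" for t p q
    using that convexD[OF \<open>convex C\<close>, of p q "1 - t" t] by simp
  \<comment> \<open>Comparing the infimum with the midpoint of two almost minimal points bounds their distance.\<close>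
  have close: "(norm (fst p - fst q))\<^sup>2 \<le> 4 * (g p - m) + 4 * (g q - m)"
    if "p \<in> C" "q \<in> C" for p q
    using m_le[OF combination_in[OF that, of "1/2"]] unfolding g_combination by simp
  have "Cauchy (\<lambda>n. fst (P n))"
  proof (rule CauchyI)
    fix e :: real
    assume "0 < e"
    then obtain M where M: "8 / e\<^sup>2 < real M"
      using reals_Archimedean2 by blast
    have "norm (fst (P k) - fst (P n)) < e" if "k \<ge> M" "n \<ge> M" for k n
    proof -
      have M_pos: "0 < real M"
        using M \<open>0 < e\<close> by (smt (verit) divide_pos_pos zero_less_power)
      have "1 / real (Suc k) \<le> 1 / real M" "1 / real (Suc n) \<le> 1 / real M"
        using that M_pos by (auto intro!: divide_left_mono)
      then have "g (P k) - m < 1 / real M" "g (P n) - m < 1 / real M"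
        using P_less[of k] P_less[of n] by auto
      then have "(norm (fst (P k) - fst (P n)))\<^sup>2 < 8 * (1 / real M)"
        using close[OF P_in P_in, of k n] by argo
      also have "\<dots> < e\<^sup>2"
        using M M_pos \<open>0 < e\<close> by (simp add: field_simps)
      finally show ?thesis
        using \<open>0 < e\<close> power_less_imp_less_base by (metis less_eq_real_def)
    qed
    then show "\<exists>M. \<forall>k\<ge>M. \<forall>n\<ge>M. norm (fst (P k) - fst (P n)) < e"
      by blast
  qed
  then obtain z0 where z0: "(\<lambda>n. fst (P n)) \<longlonglongrightarrow> z0"
    using Cauchy_convergent_iff convergent_def by blast
  have "(\<lambda>n. g (P n)) \<longlonglongrightarrow> m"
  proof (rule tendsto_sandwich[of "\<lambda>_. m" _ _ "\<lambda>n. m + 1 / real (Suc n)"])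
    show "\<forall>\<^sub>F n in sequentially. m \<le> g (P n)"
      using m_le P_in by simp
    show "\<forall>\<^sub>F n in sequentially. g (P n) \<le> m + 1 / real (Suc n)"
      using P_less less_imp_le by (intro always_eventually) blast
    show "(\<lambda>n. m + 1 / real (Suc n)) \<longlonglongrightarrow> m"
      using tendsto_add[OF tendsto_const LIMSEQ_inverse_real_of_nat, of m]
      by (simp add: inverse_eq_divide)
  qed simp
  then have "(\<lambda>n. g (P n) - (norm (fst (P n)))\<^sup>2 / 2) \<longlonglongrightarrow> m - (norm z0)\<^sup>2 / 2"
    using z0 by (intro tendsto_intros) auto
  then have snd_lim: "(\<lambda>n. snd (P n)) \<longlonglongrightarrow> m - (norm z0)\<^sup>2 / 2"
    by (simp add: g_def)
  define r0 where "r0 = m - (norm z0)\<^sup>2 / 2"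
  have "P \<longlonglongrightarrow> (z0, r0)"
    using tendsto_Pair[OF z0 snd_lim] by (simp add: r0_def)
  then have min_in: "(z0, r0) \<in> C"
    using closed_sequentially[OF \<open>closed C\<close>] P_in by blast
  have g_min: "g (z0, r0) = m"
    by (simp add: g_def r0_def)
  have "r0 + inner z0 z0 \<le> r + inner z0 z" if "(z, r) \<in> C" for z r
  proof -
    define d where "d = (norm (z0 - z))\<^sup>2 / 2"
    \<comment> \<open>Moving by a fraction \<open>t\<close> towards \<open>(z, r)\<close> does not decrease the objective; divide by \<open>t\<close>.\<close>
    have upper: "(1 - t) * d \<le> g (z, r) - m" if "0 < t" "t \<le> 1" for t
    proof -
      have "m \<le> (1 - t) * m + t * g (z, r) - t * (1 - t) * d"
        using m_le[OF combination_in[OF min_in \<open>(z, r) \<in> C\<close>, of t]] that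
        unfolding g_combination g_min by (simp add: d_def)
      then have "t * ((1 - t) * d) \<le> t * (g (z, r) - m)"
        by (simp add: algebra_simps)
      then show ?thesis
        using \<open>0 < t\<close> by simp
    qed
    have "((\<lambda>t. (1 - t) * d) \<longlongrightarrow> (1 - 0) * d) (at_right (0::real))"
      by (intro tendsto_intros)
    moreover have "\<forall>\<^sub>F t in at_right (0::real). (1 - t) * d \<le> g (z, r) - m"
      unfolding eventually_at_right_field using upper by (intro exI[of _ 1]) auto
    ultimately have "d \<le> g (z, r) - m"
      using tendsto_upperbound by fastforce
    then show ?thesis
      unfolding d_def g_min[symmetric] g_def power2_norm_eq_inner
      by (simp add: inner_commute algebra_simps) (simp add: field_simps)
  qed
  with min_in that show thesis
    by blast
qed

section \<open>Minty's theorem\<close>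

lemma monotone_op_iff:
  "monotone_op A \<longleftrightarrow> (\<forall>x u y v. u \<in> A x \<longrightarrow> v \<in> A y \<longrightarrow> 0 \<le> inner (x - y) (u - v))"
  unfolding monotone_op_def gra_def by auto

lemma maximally_monotone_op_absorbs:
  assumes "maximally_monotone_op A" and related: "\<And>y v. v \<in> A y \<Longrightarrow> 0 \<le> inner (x - y) (u - v)"
  shows "u \<in> A x"
proof (rule ccontr)
  assume "u \<notin> A x"
  define B where "B = A(x := insert u (A x))"
  have "monotone_op A"
    using assms(1) by (simp add: maximally_monotone_op_def)
  moreover have "inner (y - x) (v - u) = inner (x - y) (u - v)" for y v
    by (simp add: algebra_simps)
  ultimately have "monotone_op B"
    unfolding monotone_op_iff B_def using related by auto
  moreover have "gra A \<subset> gra B"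
    using \<open>u \<notin> A x\<close> by (auto simp: gra_def B_def)
  ultimately show False
    using assms(1) by (auto simp: maximally_monotone_op_def)
qed

text \<open>
  Replacing \<open>A\<close> by \<open>A - w\<close> reduces the claim to finding \<open>p\<close> with \<open>-p \<in> (A - w) p\<close>.
  Let \<open>F(p, q) = sup {\<langle>y, q\<rangle> + \<langle>p, v\<rangle> - \<langle>y, v\<rangle>}\<close> over the graph of \<open>A - w\<close> be its Fitzpatrick
  function, with epigraph \<open>C\<close> in the proof: maximality gives \<open>F(p, q) \<ge> \<langle>p, q\<rangle>\<close> everywhere, monotonicity \<open>F(y, v) = \<langle>y, v\<rangle>\<close>
  on the graph. The optimality condition for a minimiser \<open>(p, q)\<close> of \<open>F + \<parallel>\<cdot>\<parallel>\<^sup>2/2\<close>, tested at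
  points of the graph and combined with \<open>F(p, q) \<ge> \<langle>p, q\<rangle>\<close>, gives \<open>\<langle>y + q, v + p\<rangle> \<ge> \<parallel>p + q\<parallel>\<^sup>2\<close>. So \<open>(-q, -p)\<close> is monotonically related to
  the graph and hence belongs to it, and testing at this very point forces \<open>q = -p\<close>.
\<close>

lemma minty_surjective:
  fixes A :: "'h::{real_inner,complete_space} \<Rightarrow> 'h set"
  assumes "maximally_monotone_op A"
  obtains x where "w - x \<in> A x"
proof -
  note absorbs = maximally_monotone_op_absorbs[OF assms]
  have mono: "0 \<le> inner (x - y) (u - v)" if "u \<in> A x" "v \<in> A y" for x u y v
    using assms that by (auto simp: maximally_monotone_op_def monotone_op_iff)
  define halfspace where "halfspace = (\<lambda>y v. {((p, q), r).
    inner y q + inner p (v - w) - inner y (v - w) \<le> r} :: (('h \<times> 'h) \<times> real) set)"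
  define C where "C = (\<Inter>(y, v) \<in> gra A. halfspace y v)"
  have C_iff: "((p, q), r) \<in> C \<longleftrightarrow>
      (\<forall>y v. v \<in> A y \<longrightarrow> inner y q + inner p (v - w) - inner y (v - w) \<le> r)" for p q r
    by (auto simp: C_def halfspace_def gra_def)
  have halfspace_closed: "closed (halfspace y v)" for y v
  proof -
    have "halfspace y v = {z. inner y (snd (fst z)) + inner (fst (fst z)) (v - w)
        - inner y (v - w) \<le> snd z}"
      by (auto simp: halfspace_def)
    then show ?thesis
      by (simp add: closed_Collect_le continuous_intros)
  qed
  have halfspace_convex: "convex (halfspace y v)" for y v
  proof (rule convexI)
    fix a b :: "('h \<times> 'h) \<times> real" and s t :: real
    assume a: "a \<in> halfspace y v" and b: "b \<in> halfspace y v" and st: "0 \<le> s" "0 \<le> t" "s + t = 1"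
    obtain p q r where a_eq: "a = ((p, q), r)" by (metis surj_pair)
    obtain p' q' r' where b_eq: "b = ((p', q'), r')" by (metis surj_pair)
    define k where "k = inner y (v - w)"
    have "s * (inner y q + inner p (v - w) - k) \<le> s * r"
      using a st unfolding a_eq halfspace_def k_def by (intro mult_left_mono) auto
    moreover have "t * (inner y q' + inner p' (v - w) - k) \<le> t * r'"
      using b st unfolding b_eq halfspace_def k_def by (intro mult_left_mono) auto
    moreover have "s * k + t * k = k"
      using st by (metis distrib_right mult_1)
    ultimately have "s * inner y q + t * inner y q' + (s * inner p (v - w) + t * inner p' (v - w)) - k
        \<le> s * r + t * r'"
      by (simp add: right_diff_distrib distrib_left)
    then show "s *\<^sub>R a + t *\<^sub>R b \<in> halfspace y v"
      unfolding a_eq b_eq halfspace_def k_def by (simp add: inner_add_left inner_add_right)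
  qed
  have graph_in_C: "((y, v - w), inner y (v - w)) \<in> C" if "v \<in> A y" for y v
    unfolding C_iff using mono[OF that] by (auto simp: algebra_simps)
  have "C \<noteq> {}"
  proof -
    \<comment> \<open>The empty operator is not maximal: any point is monotonically related to it.\<close>
    have "\<exists>y v. v \<in> A y"
      using absorbs by blast
    then show ?thesis
      using graph_in_C by blast
  qed
  have fitzpatrick_ge: "inner p q \<le> r" if "((p, q), r) \<in> C" for p q r
  proof (rule ccontr)
    assume less: "\<not> inner p q \<le> r"
    have "0 \<le> inner (p - y) ((q + w) - v)" if "v \<in> A y" for y v
    proof -
      have "inner y q + inner p (v - w) - inner y (v - w) \<le> r"
        using \<open>((p, q), r) \<in> C\<close> that by (simp add: C_iff)
      with less show ?thesis
        by (simp add: algebra_simps)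
    qed
    then have "q + w \<in> A p"
      by (rule absorbs)
    with that less show False
      by (force simp: C_iff)
  qed
  have bound: "0 \<le> r + (norm z)\<^sup>2 / 2" if "(z, r) \<in> C" for z r
  proof -
    obtain p q where z: "z = (p, q)"
      by (metis surj_pair)
    have "0 \<le> inner (p + q) (p + q)"
      by simp
    with fitzpatrick_ge[of p q r] that show ?thesis
      by (simp add: z power2_norm_eq_inner inner_commute algebra_simps) argo
  qed
  have "closed C" "convex C"
    unfolding C_def using halfspace_closed halfspace_convex by (auto intro!: convex_INT)
  from quadratic_perturbation_minimizer[OF this \<open>C \<noteq> {}\<close> bound]
  obtain z0 r0 where min: "(z0, r0) \<in> C"
    "\<And>z r. (z, r) \<in> C \<Longrightarrow> r0 + inner z0 z0 \<le> r + inner z0 z"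
    by blast
  obtain p q where z0: "z0 = (p, q)"
    by (metis surj_pair)
  have test: "inner (p + q) (p + q) \<le> inner (- q - y) ((w - p) - v)" if "v \<in> A y" for y v
    using min(2)[OF graph_in_C[OF that]] fitzpatrick_ge[OF min(1)[unfolded z0]]
    by (simp add: z0 inner_commute algebra_simps)
  have "0 \<le> inner (- q - y) ((w - p) - v)" if "v \<in> A y" for y v
    using test[OF that] by (meson inner_ge_zero order_trans)
  then have mem: "w - p \<in> A (- q)"
    by (rule absorbs)
  have "p + q = 0"
    using test[OF mem] by (simp flip: power2_norm_eq_inner)
  then have "- q = p"
    by (simp add: add_eq_0_iff)
  with mem that show thesis
    by simp
qed

text \<open>
  The easy half of Minty's theorem: a point \<open>(x, u)\<close> of a monotone extension has the same sum
  \<open>x + u\<close> as some point of the original graph, and monotonicity identifies the two.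
\<close>

lemma maximally_monotone_op_if_surjective:
  assumes "monotone_op A" and surj: "\<And>w. \<exists>x. w - x \<in> A x"
  shows "maximally_monotone_op A"
proof -
  have "gra B \<subseteq> gra A" if "monotone_op B" "gra A \<subseteq> gra B" for B
  proof (clarsimp simp: gra_def)
    fix x u
    assume "u \<in> B x"
    obtain y where y: "(x + u) - y \<in> A y"
      using surj by blast
    with that have "(x + u) - y \<in> B y"
      by (auto simp: gra_def)
    with \<open>u \<in> B x\<close> \<open>monotone_op B\<close> have "0 \<le> inner (x - y) (u - ((x + u) - y))"
      unfolding monotone_op_iff by blast
    also have "\<dots> = - inner (x - y) (x - y)"
      by (simp add: algebra_simps)
    finally have "x = y"
      by (simp flip: power2_norm_eq_inner)
    with y show "u \<in> A x"
      by simp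
  qed
  with assms(1) show ?thesis
    unfolding maximally_monotone_op_def by blast
qed

section \<open>Splittings of \<open>c\<close>-monotone sets\<close>

lemma two_cost:
  fixes x :: "'h::real_inner ^ 'n::{finite,linorder}"
  shows "2 * cost x = (norm (sum_map x))\<^sup>2 - (\<Sum>i\<in>UNIV. (norm (x $ i))\<^sup>2)"
proof -
  define f where "f = (\<lambda>(i, j). inner (x $ i) (x $ j))"
  define L D U where "L = {(i::'n, j). i < j}" and "D = {(i::'n, j). i = j}"
    and "U = {(i::'n, j). j < i}"
  have "(norm (sum_map x))\<^sup>2 = sum f UNIV"
    unfolding power2_norm_eq_inner sum_map_def f_def
    by (simp add: inner_sum_left inner_sum_right sum.cartesian_product)
       (auto intro!: sum.cong simp: inner_commute)
  also have "UNIV = L \<union> D \<union> U"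
    unfolding L_def D_def U_def by auto
  also have "sum f (L \<union> D \<union> U) = sum f L + sum f D + sum f U"
    by (subst sum.union_disjoint; (subst sum.union_disjoint)?) (auto simp: L_def D_def U_def)
  also have "sum f D = (\<Sum>i\<in>UNIV. (norm (x $ i))\<^sup>2)"
    by (rule sum.reindex_bij_witness[of _ "\<lambda>i. (i, i)" fst])
       (auto simp: D_def f_def power2_norm_eq_inner)
  also have "sum f U = sum f L"
    by (rule sum.reindex_bij_witness[of _ prod.swap prod.swap])
       (auto simp: L_def U_def f_def inner_commute)
  also have "sum f L = cost x"
    unfolding cost_def f_def L_def by (simp add: case_prod_unfold)
  finally show ?thesis
    by simp
qed

lemma sum_map_split: "sum_map x = (\<Sum>i\<in>K. x $ i) + (\<Sum>i\<in>UNIV - K. x $ i)"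
  for x :: "'h::real_inner ^ 'n::finite"
  unfolding sum_map_def by (metis add.commute finite_class.finite_UNIV subset_UNIV sum.subset_diff)

text \<open>
  Exchanging the components in \<open>K\<close> turns the total sums \<open>s + t\<close> and \<open>s' + t'\<close> into \<open>s' + t\<close> and
  \<open>s + t'\<close>, and \<open>\<parallel>s + t\<parallel>\<^sup>2 + \<parallel>s' + t'\<parallel>\<^sup>2 - \<parallel>s' + t\<parallel>\<^sup>2 - \<parallel>s + t'\<parallel>\<^sup>2 = 2 \<langle>s - s', t - t'\<rangle>\<close>.
\<close>

lemma c_monotone_splitting:
  fixes \<Gamma> :: "('h::real_inner ^ 'n::{finite,linorder}) set"
  assumes "c_monotone \<Gamma>" "x \<in> \<Gamma>" "y \<in> \<Gamma>"
  shows "0 \<le> inner ((\<Sum>i\<in>K. x $ i) - (\<Sum>i\<in>K. y $ i))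
                   ((\<Sum>i\<in>UNIV - K. x $ i) - (\<Sum>i\<in>UNIV - K. y $ i))"
proof -
  define p where "p = (\<lambda>j::nat. if j = 1 then x else y)"
  define \<sigma> where "\<sigma> = (\<lambda>i. if i \<in> K then Transposition.transpose 1 2 else (id :: nat \<Rightarrow> nat))"
  define x' where "x' = (\<chi> i. if i \<in> K then y $ i else x $ i)"
  define y' where "y' = (\<chi> i. if i \<in> K then x $ i else y $ i)"
  have two: "{1..2::nat} = {1, 2}"
    by auto
  have "\<sigma> i permutes {1..2}" for i
    unfolding \<sigma>_def two by (auto intro: permutes_swap_id permutes_id)
  moreover have "\<forall>j\<in>{1..2}. p j \<in> \<Gamma>"
    using assms by (simp add: p_def)
  ultimately have "(\<Sum>j = 1..2. cost (\<chi> i. p (\<sigma> i j) $ i)) \<le> (\<Sum>j = 1..2. cost (p j))"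
    using assms(1) unfolding c_monotone_def n_c_monotone_def by blast
  moreover have "(\<chi> i. p (\<sigma> i 1) $ i) = x'" "(\<chi> i. p (\<sigma> i 2) $ i) = y'"
    by (auto simp: vec_eq_iff p_def \<sigma>_def x'_def y'_def)
  ultimately have "cost x' + cost y' \<le> cost x + cost y"
    unfolding two by (simp add: p_def)
  moreover have "(\<Sum>i\<in>UNIV. (norm (x' $ i))\<^sup>2) + (\<Sum>i\<in>UNIV. (norm (y' $ i))\<^sup>2)
      = (\<Sum>i\<in>UNIV. (norm (x $ i))\<^sup>2) + (\<Sum>i\<in>UNIV. (norm (y $ i))\<^sup>2)"
    unfolding sum.distrib[symmetric] x'_def y'_def by (intro sum.cong) auto
  ultimately have "(norm (sum_map x'))\<^sup>2 + (norm (sum_map y'))\<^sup>2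
      \<le> (norm (sum_map x))\<^sup>2 + (norm (sum_map y))\<^sup>2"
    using two_cost[of x] two_cost[of y] two_cost[of x'] two_cost[of y'] by linarith
  moreover have "(\<Sum>i\<in>K. x' $ i) = (\<Sum>i\<in>K. y $ i)" "(\<Sum>i\<in>K. y' $ i) = (\<Sum>i\<in>K. x $ i)"
    "(\<Sum>i\<in>UNIV - K. x' $ i) = (\<Sum>i\<in>UNIV - K. x $ i)"
    "(\<Sum>i\<in>UNIV - K. y' $ i) = (\<Sum>i\<in>UNIV - K. y $ i)"
    by (auto simp: x'_def y'_def intro!: sum.cong)
  ultimately show ?thesis
    unfolding sum_map_split[of _ K] power2_norm_eq_inner
    by (simp add: inner_commute algebra_simps)
qed

lemma c_monotone_inj_on_sum_map:
  fixes \<Gamma> :: "('h::real_inner ^ 'n::{finite,linorder}) set"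
  assumes "c_monotone \<Gamma>"
  shows "inj_on sum_map \<Gamma>"
proof (rule inj_onI)
  fix x y
  assume xy: "x \<in> \<Gamma>" "y \<in> \<Gamma>" "sum_map x = sum_map y"
  have "x $ k = y $ k" for k
  proof -
    have "(\<Sum>i\<in>UNIV - {k}. x $ i) - (\<Sum>i\<in>UNIV - {k}. y $ i) = - (x $ k - y $ k)"
      using xy(3) unfolding sum_map_split[of _ "{k}"] by (simp add: algebra_simps)
    then have "0 \<le> inner (x $ k - y $ k) (- (x $ k - y $ k))"
      using c_monotone_splitting[OF assms xy(1,2), of "{k}"] by simp
    then have "inner (x $ k - y $ k) (x $ k - y $ k) \<le> 0"
      unfolding inner_minus_right by simp
    then show ?thesis
      by (simp flip: power2_norm_eq_inner)
  qed
  then show "x = y"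
    by (simp add: vec_eq_iff)
qed

section \<open>Resolvents of the splitting operators\<close>

lemma mem_splitting_op_iff:
  "t \<in> splitting_op \<Gamma> K s \<longleftrightarrow> (\<exists>x\<in>\<Gamma>. s = (\<Sum>i\<in>K. x $ i) \<and> t = (\<Sum>i\<in>UNIV - K. x $ i))"
  unfolding splitting_op_def by auto

lemma monotone_splitting_op:
  assumes "c_monotone \<Gamma>"
  shows "monotone_op (splitting_op \<Gamma> K)"
  unfolding monotone_op_iff mem_splitting_op_iff using c_monotone_splitting[OF assms] by blast

lemma mem_resolvent_iff: "x \<in> resolvent A w \<longleftrightarrow> w - x \<in> A x"
  unfolding resolvent_def inverse_op_def by (auto simp: set_plus_def intro!: bexI[of _ "w - x"])

lemma resolvent_splitting_op:
  fixes \<Gamma> :: "('h::real_inner ^ 'n::finite) set"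
  shows "resolvent (splitting_op \<Gamma> K) w = (\<lambda>x. \<Sum>i\<in>K. x $ i) ` {x \<in> \<Gamma>. sum_map x = w}"
  unfolding set_eq_iff mem_resolvent_iff mem_splitting_op_iff sum_map_split[of _ K]
  by (auto simp: algebra_simps)

lemma op_dom_resolvent_splitting_op:
  fixes \<Gamma> :: "('h::real_inner ^ 'n::finite) set"
  shows "op_dom (resolvent (splitting_op \<Gamma> K)) = sum_map ` \<Gamma>"
  unfolding op_dom_def resolvent_splitting_op by auto

lemma resolvent_splitting_op_sum_map:
  assumes "c_monotone \<Gamma>" "x \<in> \<Gamma>"
  shows "resolvent (splitting_op \<Gamma> K) (sum_map x) = {\<Sum>i\<in>K. x $ i}"
proof -
  have "{y \<in> \<Gamma>. sum_map y = sum_map x} = {x}"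
    using c_monotone_inj_on_sum_map[OF assms(1)] assms(2) by (auto dest: inj_onD)
  then show ?thesis
    by (simp add: resolvent_splitting_op)
qed

text \<open>
  With \<open>Tx = s\<close> and \<open>x - Tx = t\<close>, the defining inequality \<open>\<parallel>s - s'\<parallel>\<^sup>2 + \<parallel>t - t'\<parallel>\<^sup>2 \<le> \<parallel>(s - s') + (t - t')\<parallel>\<^sup>2\<close>
  of firm nonexpansiveness is again \<open>\<langle>s - s', t - t'\<rangle> \<ge> 0\<close>.
\<close>

lemma firmly_nonexpansive_resolvent_splitting_op:
  assumes "c_monotone \<Gamma>"
  shows "firmly_nonexpansive (resolvent (splitting_op \<Gamma> K))"
proof -
  have "single_valued_op (resolvent (splitting_op \<Gamma> K))"
    unfolding single_valued_op_def op_dom_resolvent_splitting_op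
    using resolvent_splitting_op_sum_map[OF assms] by auto
  moreover have "(norm (s - s'))\<^sup>2 + (norm ((w - s) - (w' - s')))\<^sup>2 \<le> (norm (w - w'))\<^sup>2"
    if "s \<in> resolvent (splitting_op \<Gamma> K) w" "s' \<in> resolvent (splitting_op \<Gamma> K) w'" for w w' s s'
  proof -
    have "0 \<le> inner (s - s') ((w - s) - (w' - s'))"
      using monotone_splitting_op[OF assms, of K] that unfolding monotone_op_iff mem_resolvent_iff
      by blast
    then show ?thesis
      unfolding power2_norm_eq_inner by (simp add: inner_commute algebra_simps)
  qed
  ultimately show ?thesis
    unfolding firmly_nonexpansive_def gra_def by auto
qed

lemma sum_singletons: "finite K \<Longrightarrow> (\<Sum>i\<in>K. {f i}) = {\<Sum>i\<in>K. f i}"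
  for f :: "'i \<Rightarrow> 'a::comm_monoid_add"
  by (induction K rule: finite_induct) (auto simp: set_plus_def set_zero)

lemma sum_set_empty:
  fixes F :: "'i \<Rightarrow> 'a::comm_monoid_add set"
  assumes "finite K" "k \<in> K" "F k = {}"
  shows "(\<Sum>i\<in>K. F i) = {}"
  using assms by (simp add: sum.remove set_plus_def)

section \<open>The equivalences\<close>

lemma plus_orthogonal_diagonal_eq_UNIV_iff:
  fixes \<Gamma> :: "('h::real_inner ^ 'n::finite) set"
  shows "\<Gamma> + orthogonal_comp diagonal = UNIV \<longleftrightarrow> sum_map ` \<Gamma> = UNIV"
proof
  assume full: "\<Gamma> + orthogonal_comp diagonal = UNIV"
  have "w \<in> sum_map ` \<Gamma>" for w
  proof -
    fix k :: 'n
    define z :: "'h ^ 'n" where "z = (\<chi> i. if i = k then w else 0)"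
    obtain x d where "x \<in> \<Gamma>" "d \<in> orthogonal_comp diagonal" "z = x + d"
      using full set_plus_elim[of z \<Gamma> "orthogonal_comp diagonal"] by blast
    then have "sum_map x = sum_map z"
      by (simp add: orthogonal_comp_diagonal sum_map_def sum.distrib)
    also have "\<dots> = w"
      by (simp add: sum_map_def z_def)
    finally show ?thesis
      using \<open>x \<in> \<Gamma>\<close> by blast
  qed
  then show "sum_map ` \<Gamma> = UNIV"
    by blast
next
  assume surj: "sum_map ` \<Gamma> = UNIV"
  have "z \<in> \<Gamma> + orthogonal_comp diagonal" for z
  proof -
    obtain x where "x \<in> \<Gamma>" "sum_map x = sum_map z"
      using surj by (metis UNIV_I imageE)
    then have "z - x \<in> orthogonal_comp diagonal"
      by (simp add: orthogonal_comp_diagonal sum_map_def sum_subtractf)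
    then have "x + (z - x) \<in> \<Gamma> + orthogonal_comp diagonal"
      using \<open>x \<in> \<Gamma>\<close> by (intro set_plus_intro)
    then show ?thesis
      by simp
  qed
  then show "\<Gamma> + orthogonal_comp diagonal = UNIV"
    by blast
qed

lemma maximally_monotone_splitting_op_iff:
  fixes \<Gamma> :: "('h::{real_inner,complete_space} ^ 'n::{finite,linorder}) set"
  assumes "c_monotone \<Gamma>"
  shows "maximally_monotone_op (splitting_op \<Gamma> K) \<longleftrightarrow> sum_map ` \<Gamma> = UNIV"
proof -
  have dom: "(\<exists>x. w - x \<in> splitting_op \<Gamma> K x) \<longleftrightarrow> w \<in> sum_map ` \<Gamma>" for w
    unfolding op_dom_resolvent_splitting_op[of \<Gamma> K, symmetric] op_dom_def
    by (auto simp flip: mem_resolvent_iff)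
  show ?thesis
  proof
    assume "maximally_monotone_op (splitting_op \<Gamma> K)"
    then show "sum_map ` \<Gamma> = UNIV"
      using minty_surjective dom by (metis UNIV_eq_I)
  next
    assume "sum_map ` \<Gamma> = UNIV"
    then show "maximally_monotone_op (splitting_op \<Gamma> K)"
      using dom by (intro maximally_monotone_op_if_surjective monotone_splitting_op assms) blast
  qed
qed

lemma sum_resolvents_eq_identity_iff:
  fixes \<Gamma> :: "('h::real_inner ^ 'n::{finite,linorder}) set"
  assumes "c_monotone \<Gamma>"
  shows "(\<forall>w. (\<Sum>i\<in>UNIV. resolvent (splitting_op \<Gamma> {i}) w) = {w}) \<longleftrightarrow> sum_map ` \<Gamma> = UNIV"
proof
  assume id: "\<forall>w. (\<Sum>i\<in>UNIV. resolvent (splitting_op \<Gamma> {i}) w) = {w}"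
  have "w \<in> sum_map ` \<Gamma>" for w
  proof -
    fix k :: 'n
    have "resolvent (splitting_op \<Gamma> {k}) w \<noteq> {}"
      using id sum_set_empty[of UNIV k "\<lambda>i. resolvent (splitting_op \<Gamma> {i}) w"] by auto
    then show ?thesis
      by (auto simp: resolvent_splitting_op)
  qed
  then show "sum_map ` \<Gamma> = UNIV"
    by blast
next
  assume surj: "sum_map ` \<Gamma> = UNIV"
  show "\<forall>w. (\<Sum>i\<in>UNIV. resolvent (splitting_op \<Gamma> {i}) w) = {w}"
  proof
    fix w
    obtain x where "x \<in> \<Gamma>" "w = sum_map x"
      using surj by blast
    then show "(\<Sum>i\<in>UNIV. resolvent (splitting_op \<Gamma> {i}) w) = {w}"
      by (simp add: resolvent_splitting_op_sum_map[OF assms] sum_singletons sum_map_def[symmetric])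
  qed
qed

lemma maximally_c_monotone_if_surjective:
  assumes "c_monotone \<Gamma>" "sum_map ` \<Gamma> = UNIV"
  shows "maximally_c_monotone \<Gamma>"
proof -
  have "\<Gamma>' \<subseteq> \<Gamma>" if "c_monotone \<Gamma>'" "\<Gamma> \<subseteq> \<Gamma>'" for \<Gamma>'
  proof
    fix y
    assume "y \<in> \<Gamma>'"
    obtain x where "x \<in> \<Gamma>" "sum_map x = sum_map y"
      using assms(2) by (metis UNIV_I imageE)
    with \<open>y \<in> \<Gamma>'\<close> that show "y \<in> \<Gamma>"
      using c_monotone_inj_on_sum_map inj_onD by (metis subsetD)
  qed
  with assms(1) show ?thesis
    unfolding maximally_c_monotone_def by blast
qed

theorem theorem2p5:
  fixes \<Gamma> :: "('h::{real_inner,complete_space} ^ 'n::{finite,linorder}) set"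
  assumes "CARD('n) \<ge> 2"
    and "c_monotone \<Gamma>"
  shows
    "let
       A = splitting_op \<Gamma>;
       J = (\<lambda>K. resolvent (A K));
       P1 = (\<forall>K. K \<noteq> {} \<and> K \<subset> UNIV \<longrightarrow> maximally_monotone_op (A K));
       P2 = (\<exists>K. K \<noteq> {} \<and> K \<subset> UNIV \<and> maximally_monotone_op (A K));
       P3 = (\<Gamma> + orthogonal_comp diagonal = UNIV);
       P4 = (\<forall>x. (\<Sum>i \<in> UNIV. J {i} x) = {x});
       P5 = (\<forall>K. K \<noteq> {} \<and> K \<subset> UNIV \<longrightarrow>
               firmly_nonexpansive (J K) \<and> op_dom (J K) = UNIV \<and>
               (\<forall>x. J K x = (\<Sum>i \<in> K. J {i} x)));
       P6 = (sum_map ` \<Gamma> = UNIV)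
     in (P1 \<longleftrightarrow> P2) \<and> (P2 \<longleftrightarrow> P3) \<and> (P3 \<longleftrightarrow> P4) \<and> (P4 \<longleftrightarrow> P5) \<and> (P5 \<longleftrightarrow> P6) \<and>
        (P1 \<longrightarrow> maximally_c_monotone \<Gamma>)"
proof -
  define J where "J = (\<lambda>K. resolvent (splitting_op \<Gamma> K))"
  obtain k :: 'n where "{k} \<noteq> UNIV"
    using assms(1) by (metis One_nat_def card.empty card.insert empty_iff finite.emptyI
        not_less_eq_eq numeral_2_eq_2 order_refl)
  then have proper: "{k} \<noteq> {} \<and> {k} \<subset> UNIV"
    by blast
  have P5: "(\<forall>K. K \<noteq> {} \<and> K \<subset> UNIV \<longrightarrow>
      firmly_nonexpansive (J K) \<and> op_dom (J K) = UNIV \<and> (\<forall>x. J K x = (\<Sum>i \<in> K. J {i} x)))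
      \<longleftrightarrow> sum_map ` \<Gamma> = UNIV" (is "?P5 \<longleftrightarrow> _")
  proof
    assume ?P5
    then have "op_dom (J {k}) = UNIV"
      using proper by blast
    then show "sum_map ` \<Gamma> = UNIV"
      by (simp add: J_def op_dom_resolvent_splitting_op)
  next
    assume surj: "sum_map ` \<Gamma> = UNIV"
    have "J K w = (\<Sum>i \<in> K. J {i} w)" for K w
    proof -
      obtain x where "x \<in> \<Gamma>" "w = sum_map x"
        using surj by blast
      then show ?thesis
        by (simp add: J_def resolvent_splitting_op_sum_map[OF assms(2)] sum_singletons)
    qed
    moreover have "firmly_nonexpansive (J K)" for K
      unfolding J_def by (rule firmly_nonexpansive_resolvent_splitting_op[OF assms(2)])
    moreover have "op_dom (J K) = UNIV" for K
      unfolding J_def op_dom_resolvent_splitting_op by (rule surj)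
    ultimately show ?P5
      by blast
  qed
  note maximal_iff = maximally_monotone_splitting_op_iff[OF assms(2)]
  have P1: "(\<forall>K. K \<noteq> {} \<and> K \<subset> UNIV \<longrightarrow> maximally_monotone_op (splitting_op \<Gamma> K))
      \<longleftrightarrow> sum_map ` \<Gamma> = UNIV"
    unfolding maximal_iff using proper by metis
  have P2: "(\<exists>K. K \<noteq> {} \<and> K \<subset> UNIV \<and> maximally_monotone_op (splitting_op \<Gamma> K))
      \<longleftrightarrow> sum_map ` \<Gamma> = UNIV"
    unfolding maximal_iff using proper by metis
  have "sum_map ` \<Gamma> = UNIV \<longrightarrow> maximally_c_monotone \<Gamma>"
    using maximally_c_monotone_if_surjective[OF assms(2)] by simp
  then show ?thesis
    unfolding Let_def P1 P2 plus_orthogonal_diagonal_eq_UNIV_iff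
      sum_resolvents_eq_identity_iff[OF assms(2)] P5[unfolded J_def]
    by (intro conjI refl)
qed

end
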